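(* Let $\pi^{(1)},\dots,\pi^{(K)}$ be target policies in a finite-horizon MDP with horizon $T$, and let $\Lambda$ be the set of all policies $\mu$ such that for all $k\in\{1,\dots,K\}$, $t\in\{0,\dots,T-1\}$, $s\in\mathcal S$, $a\in\mathcal A$: $\mu_t(a|s)=0$ implies $\pi^{(k)}_t(a|s)\,q_{\pi^{(k)},t}(s,a)=0$. Then for every $\mu\in\Lambda$, every $k\in\{1,\dots,K\}$, every $t\in\{0,\dots,T-1\}$ and every $s\in\mathcal S$, $$\mathbb E\left[G^{\mathrm{PDIS}}_k\left(\tau^{\mu_{t:T-1}}_{t:T-1}\right)\,\middle|\, S_t=s\right]=v_{\pi^{(k)},t}(s).$$
   Context: Setting. A finite-horizon MDP has a finite state space $\mathcal S$, finite action space $\mathcal A$, deterministic reward function $r:\mathcal S\times\mathcal A\to\mathbb R$, transition probabilities $p(s'|s,a)$, and horizon $T\ge 1$. A (time-dependent) policy is a family $\mu=(\mu_t)_{t=0}^{T-1}$ where $\mu_t(\cdot|s)$ is a probability distribution on $\mathcal A$ for every $s$. Under $\mu$, at time $t$, $A_t\sim\mu_t(\cdot|S_t)$, $R_{t+1}=r(S_t,A_t)$, $S_{t+1}\sim p(\cdot|S_t,A_t)$. There are $K\ge1$ target policies $\pi^{(1)},\dots,\pi^{(K)}$. Conditioning on $S_t=s$ means starting the process at time $t$ in state $s$. Value functions (undiscounted): $v_{\pi,t}(s)=\mathbb E_\pi[\sum_{i=t+1}^T R_i\mid S_t=s]$ and $q_{\pi,t}(s,a)=\mathbb E_\pi[\sum_{i=t+1}^T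 R_i\mid S_t=s,A_t=a]$. $\tau^{\mu_{t:T-1}}_{t:T-1}=\{S_t,A_t,R_{t+1},\dots,S_{T-1},A_{T-1},R_T\}$ denotes a random trajectory segment generated by $\mu$ from time $t$ to $T-1$. The per-decision importance sampling (PDIS) estimator for $\pi^{(k)}$ from data generated by $\mu$ is $$G^{\mathrm{PDIS}}_k\left(\tau^{\mu_{t:T-1}}_{t:T-1}\right)=\sum_{i=t}^{T-1}\left(\prod_{j=t}^{i}\rho^{\pi^{(k)},\mu}_j\right)R_{i+1},\qquad \rho^{\pi^{(k)},\mu}_j=\frac{\pi^{(k)}_j(A_j|S_j)}{\mu_j(A_j|S_j)}.$$ (Actions with $\mu_j(A_j|S_j)=0$ are never sampled, so the ratio is almost surely well defined.) *)

theory Defs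
  imports "HOL-Probability.Probability"
begin

record ('s, 'a) mdp =
  reward :: "'s \<Rightarrow> 'a \<Rightarrow> real"
  trans :: "'s \<Rightarrow> 'a \<Rightarrow> 's pmf"
  horizon :: nat

text \<open>Only the values \<open>\<mu> t\<close> of a policy with \<open>t < horizon M\<close> are ever used.\<close>

type_synonym ('s, 'a) policy = "nat \<Rightarrow> 's \<Rightarrow> 'a pmf"

text \<open>The entry at position \<open>j - t\<close> of a segment starting at time \<open>t\<close> is
  the triple of \<open>S\<close> at \<open>j\<close>, \<open>A\<close> at \<open>j\<close> and \<open>R\<close> at \<open>j + 1\<close>.\<close>

type_synonym ('s, 'a) segment = "('s \<times> 'a \<times> real) list"

text \<open>Law of the segment of length \<open>n\<close> started at time \<open>t\<close> in state \<open>s\<close>; and law of the segment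
  of length \<open>Suc n\<close> started at time \<open>t\<close> in state \<open>s\<close> with action \<open>a\<close>. The latter is the meaning
  of conditioning on state and action, also when the policy gives \<open>a\<close> probability \<open>0\<close>.\<close>

fun law_S :: "('s, 'a) mdp \<Rightarrow> ('s, 'a) policy \<Rightarrow> nat \<Rightarrow> nat \<Rightarrow> 's \<Rightarrow> ('s, 'a) segment pmf"
  and law_SA :: "('s, 'a) mdp \<Rightarrow> ('s, 'a) policy \<Rightarrow> nat \<Rightarrow> nat \<Rightarrow> 's \<Rightarrow> 'a \<Rightarrow> ('s, 'a) segment pmf"
where
  "law_S M \<mu> 0 t s = return_pmf []"
| "law_S M \<mu> (Suc n) t s = bind_pmf (\<mu> t s) (\<lambda>a. law_SA M \<mu> n t s a)"
| "law_SA M \<mu> n t s a =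
     bind_pmf (trans M s a) (\<lambda>s'. map_pmf ((#) (s, a, reward M s a)) (law_S M \<mu> n (Suc t) s'))"

definition seg_S :: "('s, 'a) mdp \<Rightarrow> ('s, 'a) policy \<Rightarrow> nat \<Rightarrow> 's \<Rightarrow> ('s, 'a) segment pmf" where
  "seg_S M \<mu> t s = law_S M \<mu> (horizon M - t) t s"

definition seg_SA :: "('s, 'a) mdp \<Rightarrow> ('s, 'a) policy \<Rightarrow> nat \<Rightarrow> 's \<Rightarrow> 'a \<Rightarrow> ('s, 'a) segment pmf" where
  "seg_SA M \<mu> t s a = law_SA M \<mu> (horizon M - Suc t) t s a"

definition state_at :: "nat \<Rightarrow> ('s, 'a) segment \<Rightarrow> nat \<Rightarrow> 's" where
  "state_at t \<tau> j = fst (\<tau> ! (j - t))"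

definition action_at :: "nat \<Rightarrow> ('s, 'a) segment \<Rightarrow> nat \<Rightarrow> 'a" where
  "action_at t \<tau> j = fst (snd (\<tau> ! (j - t)))"

text \<open>Rewards are indexed by the time at which they are received, so \<open>i\<close> ranges over
  \<open>{t + 1..horizon M}\<close>.\<close>

definition reward_at :: "nat \<Rightarrow> ('s, 'a) segment \<Rightarrow> nat \<Rightarrow> real" where
  "reward_at t \<tau> i = snd (snd (\<tau> ! (i - Suc t)))"

definition v_value :: "('s, 'a) mdp \<Rightarrow> ('s, 'a) policy \<Rightarrow> nat \<Rightarrow> 's \<Rightarrow> real" where
  "v_value M \<pi> t s =
     measure_pmf.expectation (seg_S M \<pi> t s) (\<lambda>\<tau>. \<Sum>i = t + 1..horizon M. reward_at t \<tau> i)"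

definition q_value :: "('s, 'a) mdp \<Rightarrow> ('s, 'a) policy \<Rightarrow> nat \<Rightarrow> 's \<Rightarrow> 'a \<Rightarrow> real" where
  "q_value M \<pi> t s a =
     measure_pmf.expectation (seg_SA M \<pi> t s a) (\<lambda>\<tau>. \<Sum>i = t + 1..horizon M. reward_at t \<tau> i)"

definition is_ratio ::
  "('s, 'a) policy \<Rightarrow> ('s, 'a) policy \<Rightarrow> nat \<Rightarrow> ('s, 'a) segment \<Rightarrow> nat \<Rightarrow> real" where
  "is_ratio \<pi> \<mu> t \<tau> j =
     pmf (\<pi> j (state_at t \<tau> j)) (action_at t \<tau> j) / pmf (\<mu> j (state_at t \<tau> j)) (action_at t \<tau> j)"

definition G_PDIS ::
  "('s, 'a) mdp \<Rightarrow> ('s, 'a) policy \<Rightarrow> ('s, 'a) policy \<Rightarrow> nat \<Rightarrow> ('s, 'a) segment \<Rightarrow> real" where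
  "G_PDIS M \<pi> \<mu> t \<tau> =
     (\<Sum>i = t..<horizon M. (\<Prod>j = t..i. is_ratio \<pi> \<mu> t \<tau> j) * reward_at t \<tau> (i + 1))"

definition Lambda_set ::
  "('s, 'a) mdp \<Rightarrow> nat \<Rightarrow> (nat \<Rightarrow> ('s, 'a) policy) \<Rightarrow> ('s, 'a) policy set" where
  "Lambda_set M K \<pi> = {\<mu>. \<forall>k\<in>{1..K}. \<forall>t<horizon M. \<forall>s a.
     pmf (\<mu> t s) a = 0 \<longrightarrow> pmf (\<pi> k t s) a * q_value M (\<pi> k) t s a = 0}"

end

(* Proof idea: both sides satisfy a backward recursion in the number of remaining steps.  With
   W for the expected PDIS return, W_t(s) = sum_a mu(a|s) * rho(a|s) * (r(s,a) + E[W_{t+1}(S')]).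
   By induction the bracket equals q_t(s,a), and mu * rho * q = pi * q for every action: where
   mu(a|s) = 0, the left side vanishes and the right side does so by the condition defining
   Lambda. *)

theory Submission
  imports Defs
begin

lemma length_law_S: "\<tau> \<in> set_pmf (law_S M \<mu> n t s) \<Longrightarrow> length \<tau> = n"
  by (induction n arbitrary: t s \<tau>) auto

lemma length_law_SA: "\<tau> \<in> set_pmf (law_SA M \<mu> n t s a) \<Longrightarrow> length \<tau> = Suc n"
  by (auto dest: length_law_S)

text \<open>Finite support makes every real function of a segment integrable, so expectations can be
  split linearly and expanded as finite sums.\<close>

lemma finite_set_law_S:
  fixes M :: "('s::finite, 'a::finite) mdp"
  shows "finite (set_pmf (law_S M \<mu> n t s))"
  by (induction n arbitrary: t s) auto

lemma expectation_law_S_Suc: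
  fixes M :: "('s::finite, 'a::finite) mdp" and f :: "('s, 'a) segment \<Rightarrow> real"
  shows "measure_pmf.expectation (law_S M \<mu> (Suc n) t s) f =
    (\<Sum>a\<in>UNIV. pmf (\<mu> t s) a * measure_pmf.expectation (law_SA M \<mu> n t s a) f)"
  by (simp add: pmf_expectation_bind[where A = UNIV] finite_set_law_S)

text \<open>The single recursion step behind both sides: with \<open>c = 1\<close> it unrolls the
  plain return, with \<open>c\<close> the importance ratio of the first decision it unrolls the PDIS
  return. Once state and action are fixed, \<open>c\<close> and the reward are constants, so only
  the tail term \<open>g\<close> is averaged over successors.\<close>

lemma expectation_law_SA_affine:
  fixes M :: "('s::finite, 'a::finite) mdp" and f :: "('s, 'a) segment \<Rightarrow> real"
  assumes "\<And>\<tau>. f ((s, a, reward M s a) # \<tau>) = c * (reward M s a + g \<tau>)"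
  shows "measure_pmf.expectation (law_SA M \<mu> n t s a) f =
    c * (reward M s a + (\<Sum>s'\<in>UNIV. pmf (trans M s a) s' *
      measure_pmf.expectation (law_S M \<mu> n (Suc t) s') g))"
proof -
  have E: "measure_pmf.expectation (law_S M \<mu> n (Suc t) s') (\<lambda>\<tau>. f ((s, a, reward M s a) # \<tau>)) =
      c * (reward M s a + measure_pmf.expectation (law_S M \<mu> n (Suc t) s') g)" for s'
    by (simp add: assms integrable_measure_pmf_finite finite_set_law_S)
  \<comment> \<open>Lets the constant \<open>c * reward M s a\<close> leave the average over
    successor states.\<close>
  have "(\<Sum>s'\<in>UNIV. pmf (trans M s a) s') = 1"
    by (rule sum_pmf_eq_1) auto
  then show ?thesis
    by (simp add: pmf_expectation_bind[where A = UNIV] finite_set_law_S E algebra_simps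
        sum.distrib flip: sum_distrib_left)
qed

definition return_of :: "('s, 'a) segment \<Rightarrow> real" where
  "return_of \<tau> = (\<Sum>(s, a, r)\<leftarrow>\<tau>. r)"

text \<open>Horner form of the estimator: each product of ratios starts with the one at time
  \<open>t\<close>, which is pulled out of the whole sum. This matches the recursion of
  \<open>law_S\<close>.\<close>

fun pdis :: "('s, 'a) policy \<Rightarrow> ('s, 'a) policy \<Rightarrow> nat \<Rightarrow> ('s, 'a) segment \<Rightarrow> real" where
  "pdis \<pi> \<mu> t [] = 0"
| "pdis \<pi> \<mu> t ((s, a, r) # \<tau>) = pmf (\<pi> t s) a / pmf (\<mu> t s) a * (r + pdis \<pi> \<mu> (Suc t) \<tau>)"

lemma sum_reward_at_eq_return_of: "(\<Sum>i = t + 1..t + length \<tau>. reward_at t \<tau> i) = return_of \<tau>"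
proof (induction \<tau> arbitrary: t)
  case Nil
  then show ?case by (simp add: return_of_def)
next
  case (Cons x \<tau>)
  \<comment> \<open>Dropping the head while advancing the start time leaves absolute times
    unchanged.\<close>
  have shift: "reward_at t (x # \<tau>) i = reward_at (Suc t) \<tau> i" if "i \<in> {Suc t + 1..Suc t + length \<tau>}" for i
  proof -
    have "i - Suc t = Suc (i - Suc (Suc t))" using that by auto
    then show ?thesis by (simp add: reward_at_def)
  qed
  have "(\<Sum>i = t + 1..t + length (x # \<tau>). reward_at t (x # \<tau>) i) =
      reward_at t (x # \<tau>) (t + 1) + (\<Sum>i = Suc t + 1..Suc t + length \<tau>. reward_at t (x # \<tau>) i)"
    by (subst sum.atLeast_Suc_atMost) simp_all
  also have "\<dots> = snd (snd x) + return_of \<tau>"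
    unfolding Cons.IH[of "Suc t", symmetric] using shift
    by (intro arg_cong2[where f = "(+)"] sum.cong) (simp_all add: reward_at_def)
  finally show ?case by (simp add: return_of_def split_beta)
qed

lemma sum_ratio_reward_eq_pdis:
  "(\<Sum>i = t..<t + length \<tau>. (\<Prod>j = t..i. is_ratio \<pi> \<mu> t \<tau> j) * reward_at t \<tau> (i + 1)) =
    pdis \<pi> \<mu> t \<tau>"
proof (induction \<tau> arbitrary: t)
  case Nil
  then show ?case by simp
next
  case (Cons x \<tau>)
  obtain s a r where x: "x = (s, a, r)" by (cases x)
  define c where "c = is_ratio \<pi> \<mu> t (x # \<tau>) t"
  have c: "c = pmf (\<pi> t s) a / pmf (\<mu> t s) a"
    by (simp add: c_def x is_ratio_def state_at_def action_at_def)
  have nth: "(x # \<tau>) ! (j - t) = \<tau> ! (j - Suc t)" if "Suc t \<le> j" for j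
  proof -
    have "j - t = Suc (j - Suc t)" using that by auto
    then show ?thesis by simp
  qed
  have ratio: "is_ratio \<pi> \<mu> t (x # \<tau>) j = is_ratio \<pi> \<mu> (Suc t) \<tau> j" if "Suc t \<le> j" for j
    using nth[OF that] by (simp add: is_ratio_def state_at_def action_at_def)
  \<comment> \<open>Every later summand is \<open>c\<close> times the corresponding summand of the
    tail's own estimator, started at \<open>Suc t\<close>.\<close>
  have summand: "(\<Prod>j = t..i. is_ratio \<pi> \<mu> t (x # \<tau>) j) * reward_at t (x # \<tau>) (i + 1) =
      c * ((\<Prod>j = Suc t..i. is_ratio \<pi> \<mu> (Suc t) \<tau> j) * reward_at (Suc t) \<tau> (i + 1))"
    if "i \<in> {Suc t..<Suc t + length \<tau>}" for i
  proof -
    have "(\<Prod>j = t..i. is_ratio \<pi> \<mu> t (x # \<tau>) j) = c * (\<Prod>j = Suc t..i. is_ratio \<pi> \<mu> t (x # \<tau>) j)"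
      using that by (simp add: prod.atLeast_Suc_atMost c_def)
    also have "(\<Prod>j = Suc t..i. is_ratio \<pi> \<mu> t (x # \<tau>) j) =
        (\<Prod>j = Suc t..i. is_ratio \<pi> \<mu> (Suc t) \<tau> j)"
      by (rule prod.cong) (simp_all add: ratio)
    finally show ?thesis
      using nth[of i] that by (simp add: reward_at_def)
  qed
  have "(\<Sum>i = t..<t + length (x # \<tau>).
        (\<Prod>j = t..i. is_ratio \<pi> \<mu> t (x # \<tau>) j) * reward_at t (x # \<tau>) (i + 1)) =
      c * r + (\<Sum>i = Suc t..<Suc t + length \<tau>.
        (\<Prod>j = t..i. is_ratio \<pi> \<mu> t (x # \<tau>) j) * reward_at t (x # \<tau>) (i + 1))"
    by (subst sum.atLeast_Suc_lessThan) (simp_all add: c_def reward_at_def x)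
  also have "\<dots> = c * r + c * pdis \<pi> \<mu> (Suc t) \<tau>"
    unfolding Cons.IH[of "Suc t", symmetric] sum_distrib_left
    using summand by (intro arg_cong2[where f = "(+)"] sum.cong) simp_all
  finally show ?case by (simp only: x c pdis.simps distrib_left)
qed

text \<open>The two integrands agree only on segments of length \<open>horizon M - t\<close>, hence
  equality almost surely rather than pointwise.\<close>

lemma v_value_eq:
  assumes "t \<le> horizon M"
  shows "v_value M \<pi> t s = measure_pmf.expectation (law_S M \<pi> (horizon M - t) t s) return_of"
  unfolding v_value_def seg_S_def
proof (rule integral_cong_AE)
  show "AE \<tau> in law_S M \<pi> (horizon M - t) t s.
      (\<Sum>i = t + 1..horizon M. reward_at t \<tau> i) = return_of \<tau>"
    using assms by (auto simp: AE_measure_pmf_iff dest!: length_law_S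
      simp flip: sum_reward_at_eq_return_of[of t])
qed simp_all

lemma q_value_eq:
  assumes "t < horizon M"
  shows "q_value M \<pi> t s a =
    measure_pmf.expectation (law_SA M \<pi> (horizon M - Suc t) t s a) return_of"
  unfolding q_value_def seg_SA_def
proof (rule integral_cong_AE)
  show "AE \<tau> in law_SA M \<pi> (horizon M - Suc t) t s a.
      (\<Sum>i = t + 1..horizon M. reward_at t \<tau> i) = return_of \<tau>"
    unfolding AE_measure_pmf_iff
  proof
    fix \<tau> assume "\<tau> \<in> set_pmf (law_SA M \<pi> (horizon M - Suc t) t s a)"
    then have "t + length \<tau> = horizon M"
      using assms by (auto dest!: length_law_SA simp del: law_SA.simps)
    then show "(\<Sum>i = t + 1..horizon M. reward_at t \<tau> i) = return_of \<tau>"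
      using sum_reward_at_eq_return_of[of t \<tau>] by simp
  qed
qed simp_all

lemma expectation_G_PDIS_eq:
  assumes "t \<le> horizon M"
  shows "measure_pmf.expectation (seg_S M \<mu> t s) (G_PDIS M \<pi> \<mu> t) =
    measure_pmf.expectation (law_S M \<mu> (horizon M - t) t s) (pdis \<pi> \<mu> t)"
  unfolding seg_S_def
proof (rule integral_cong_AE)
  show "AE \<tau> in law_S M \<mu> (horizon M - t) t s. G_PDIS M \<pi> \<mu> t \<tau> = pdis \<pi> \<mu> t \<tau>"
    using assms by (auto simp: AE_measure_pmf_iff G_PDIS_def dest!: length_law_S
      simp flip: sum_ratio_reward_eq_pdis[of _ _ t])
qed simp_all

text \<open>Induction on the number \<open>n\<close> of remaining steps, for all \<open>t\<close>
  and \<open>s\<close> at once, as the tail starts later and in another state. The invariant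
  \<open>t + n = horizon M\<close> ties \<open>q_value\<close> to laws of the right length.\<close>

lemma expectation_pdis:
  fixes M :: "('s::finite, 'a::finite) mdp"
  assumes cover: "\<And>t s a. t < horizon M \<Longrightarrow> pmf (\<mu> t s) a = 0 \<Longrightarrow>
      pmf (\<pi> t s) a * q_value M \<pi> t s a = 0"
    and "t + n = horizon M"
  shows "measure_pmf.expectation (law_S M \<mu> n t s) (pdis \<pi> \<mu> t) =
    measure_pmf.expectation (law_S M \<pi> n t s) return_of"
  using assms(2)
proof (induction n arbitrary: t s)
  case 0
  then show ?case by (simp add: return_of_def)
next
  case (Suc n)
  have n: "horizon M - Suc t = n" and t: "t < horizon M" using Suc.prems by auto
  have q: "q_value M \<pi> t s a = reward M s a + (\<Sum>s'\<in>UNIV. pmf (trans M s a) s' *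
      measure_pmf.expectation (law_S M \<pi> n (Suc t) s') return_of)" for a
    unfolding q_value_eq[OF t] n
    by (subst expectation_law_SA_affine[where c = 1 and g = return_of])
       (simp_all add: return_of_def)
  \<comment> \<open>This holds even for actions that \<mu> never takes: the ratio is then 0 by the
    convention for division by zero, and both sides vanish.\<close>
  have W: "measure_pmf.expectation (law_SA M \<mu> n t s a) (pdis \<pi> \<mu> t) =
      pmf (\<pi> t s) a / pmf (\<mu> t s) a * q_value M \<pi> t s a" for a
    unfolding q
    by (subst expectation_law_SA_affine[where g = "pdis \<pi> \<mu> (Suc t)"
          and c = "pmf (\<pi> t s) a / pmf (\<mu> t s) a"])
       (use Suc.IH[of "Suc t"] Suc.prems in simp_all)
  have "pmf (\<mu> t s) a * (pmf (\<pi> t s) a / pmf (\<mu> t s) a * q_value M \<pi> t s a) =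
      pmf (\<pi> t s) a * q_value M \<pi> t s a" for a
    using cover[OF t, of s a] by (cases "pmf (\<mu> t s) a = 0") simp_all
  \<comment> \<open>Averaging over the first action turns the left side into the sum of \<pi> times
    \<open>q_value\<close>, which is the expansion of the expected return under \<pi>.\<close>
  then show ?case
    unfolding expectation_law_S_Suc W by (simp add: q_value_eq[OF t] n del: law_SA.simps)
qed

theorem theorem1:
  fixes M :: "('s::finite, 'a::finite) mdp"
    and K :: nat
    and \<pi> :: "nat \<Rightarrow> ('s, 'a) policy"
  assumes "horizon M \<ge> 1" and "K \<ge> 1"
  shows "\<forall>\<mu>\<in>Lambda_set M K \<pi>. \<forall>k\<in>{1..K}. \<forall>t<horizon M. \<forall>s.
    measure_pmf.expectation (seg_S M \<mu> t s) (G_PDIS M (\<pi> k) \<mu> t) = v_value M (\<pi> k) t s"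
proof (intro ballI allI impI)
  fix \<mu> k t s
  assume mu: "\<mu> \<in> Lambda_set M K \<pi>" and k: "k \<in> {1..K}" and t: "t < horizon M"
  show "measure_pmf.expectation (seg_S M \<mu> t s) (G_PDIS M (\<pi> k) \<mu> t) = v_value M (\<pi> k) t s"
    using t expectation_pdis[of M \<mu> "\<pi> k" t "horizon M - t" s] mu k
    by (simp add: expectation_G_PDIS_eq v_value_eq Lambda_set_def)
qed

end
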